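(* Let $p,N\ge 1$ be integers, let $H=[h_1,\dots,h_N]\in\mathbb{R}^{p\times N}$ and let $\alpha_1,\dots,\alpha_N>0$. The volume maximization problem $$\max_{V=[v_1,\dots,v_N]\in\mathbb{R}^{p\times N}:\ \|v_i\|_2^2\le\alpha_i\ \forall i}\ \ \sum_{\mathbb{I}\subseteq\{1,\dots,N\}}\mathrm{Volume}\big(\mathcal{P}(\{h_i+v_i\}_{i\in\mathbb{I}})\big)^2$$ is equivalent to the log-determinant problem $$\min_{V=[v_1,\dots,v_N]\in\mathbb{R}^{p\times N}:\ \|v_i\|_2^2\le\alpha_i\ \forall i}\ \ \ell(V),\qquad \ell(V)=-\log\det\big[I+(H+V)^\top(H+V)\big],$$ i.e. a feasible $V$ is an optimal solution of the first problem if and only if it is an optimal solution of the second.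
   Context: For a finite indexed family of vectors $w_1,\dots,w_n\in\mathbb{R}^p$, the parallelepiped they span is $\mathcal{P}(\{w_1,\dots,w_n\})=\{\sum_{i=1}^n\lambda_i w_i:\lambda\in[0,1]^n\}$. $\mathrm{Volume}(\mathcal{P}(\{w_1,\dots,w_n\}))$ denotes its $n$-dimensional volume (so it is $0$ if the $w_i$ are linearly dependent, in particular whenever $n>p$); for the empty family the volume is taken to be $1$. The sum ranges over all subsets $\mathbb{I}$ of the index set $\{1,\dots,N\}$. $I$ is the $N\times N$ identity matrix and $\|\cdot\|_2$ is the Euclidean norm. *)

theory Defs
  imports "HOL-Analysis.Analysis"
begin

definition orthonormal :: "'a::euclidean_space set \<Rightarrow> bool" where
  "orthonormal B \<longleftrightarrow> pairwise orthogonal B \<and> (\<forall>b\<in>B. norm b = 1)"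

text \<open>
  Lebesgue measure on the subspace \<^term>\<open>span B\<close>, for an orthonormal set \<^term>\<open>B\<close>, as a
  measure on the ambient space: the construction is that of \<^const>\<open>lborel\<close>, with
  \<^term>\<open>B\<close> in place of \<^const>\<open>Basis\<close>. For empty \<^term>\<open>B\<close> it is the unit point mass at 0.
\<close>

definition lborel_span :: "'a::euclidean_space set \<Rightarrow> 'a measure" where
  "lborel_span B = distr (\<Pi>\<^sub>M b\<in>B. (lborel :: real measure)) borel (\<lambda>c. \<Sum>b\<in>B. c b *\<^sub>R b)"

text \<open>
  The \<^term>\<open>n\<close>-dimensional volume of a Borel set \<^term>\<open>S\<close> lying in some \<^term>\<open>n\<close>-dimensional
  linear subspace. The choice of the orthonormal basis (and of the subspace, if
  \<^term>\<open>S\<close> spans less than \<^term>\<open>n\<close> dimensions, in which case the volume is 0) is immaterial, as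
  Lebesgue measure is invariant under orthogonal maps. If there is no such subspace the value
  is 0; for a parallelepiped spanned by \<^term>\<open>n\<close> vectors this happens exactly when
  \<^term>\<open>n\<close> exceeds the dimension of the ambient space.
\<close>

definition volume :: "nat \<Rightarrow> 'a::euclidean_space set \<Rightarrow> real" where
  "volume n S =
    (if \<exists>B. orthonormal B \<and> finite B \<and> card B = n \<and> S \<subseteq> span B
     then measure (lborel_span (SOME B. orthonormal B \<and> finite B \<and> card B = n \<and> S \<subseteq> span B)) S
     else 0)"

definition parallelepiped :: "'i set \<Rightarrow> ('i \<Rightarrow> 'a::real_vector) \<Rightarrow> 'a set" where
  "parallelepiped I w = {\<Sum>i\<in>I. c i *\<^sub>R w i | c. \<forall>i\<in>I. c i \<in> {0..1::real}}"

definition feasible :: "('n \<Rightarrow> real) \<Rightarrow> real^'n^'p \<Rightarrow> bool" where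
  "feasible \<alpha> V \<longleftrightarrow> (\<forall>i. (norm (column i V))\<^sup>2 \<le> \<alpha> i)"

text \<open>The dimension is the size of the index set, so repeated vectors count separately.\<close>

definition volume_objective :: "real^'n^'p \<Rightarrow> real^'n^'p \<Rightarrow> real" where
  "volume_objective H V =
    (\<Sum>I\<in>Pow (UNIV :: 'n set).
      (volume (card I) (parallelepiped I (\<lambda>i. column i H + column i V)))\<^sup>2)"

definition logdet_loss :: "real^'n^'p \<Rightarrow> real^'n^'p \<Rightarrow> real" where
  "logdet_loss H V = - ln (det (mat 1 + transpose (H + V) ** (H + V)))"

end

theory Submission
  imports Defs
begin

text \<open>
  Expanding the Leibniz formula for \<open>det (1 + A)\<close> gives the sum of all principal minors of \<open>A\<close>. For
  the Gram matrix \<open>A = (H + V)\<^sup>T (H + V)\<close> the minor indexed by \<open>I\<close> is the squared volume of the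
  parallelepiped spanned by the columns in \<open>I\<close>. Hence the volume objective equals
  \<open>det (1 + (H + V)\<^sup>T (H + V))\<close>, and \<open>- ln\<close> is strictly decreasing.

  Since the dimension \<open>card I\<close> is not a type, both the determinants and the volumes are computed in
  a fixed larger dimension: the matrix is padded with the identity, and the parallelepiped with a
  unit cube in the complementary coordinates.
\<close>

section \<open>Principal minors and the expansion of \<open>det (mat 1 + A)\<close>\<close>

definition principal_minor :: "'i set \<Rightarrow> ('i \<Rightarrow> 'i \<Rightarrow> real) \<Rightarrow> real" where
  "principal_minor I A = (\<Sum>p | p permutes I. of_int (sign p) * (\<Prod>i\<in>I. A i (p i)))"

lemma principal_minor_cong:
  assumes "\<And>i j. i \<in> I \<Longrightarrow> j \<in> I \<Longrightarrow> A i j = B i j"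
  shows "principal_minor I A = principal_minor I B"
  unfolding principal_minor_def
  by (intro sum.cong refl arg_cong2[where f = "(*)"] prod.cong)
     (auto simp: assms permutes_in_image)

text \<open>The product over the rows outside \<open>I\<close> is the indicator that
  \<open>p\<close> fixes every index outside \<open>I\<close>, so only the permutations of
  \<open>I\<close> survive. This serves both for choosing identity rows in \<open>mat 1 + A\<close>
  and for padding a matrix with the identity.\<close>

lemma sum_permutes_identity_rows:
  fixes A :: "'n::finite \<Rightarrow> 'n \<Rightarrow> real"
  shows "(\<Sum>p | p permutes UNIV. of_int (sign p) *
      ((\<Prod>i\<in>I. A i (p i)) * (\<Prod>i\<in>UNIV - I. if i = p i then 1 else 0))) = principal_minor I A"
proof -
  have "(\<Prod>i\<in>UNIV - I. if i = p i then 1 else 0) = (if p permutes I then 1 else 0 :: real)"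
    if p: "p permutes UNIV" for p :: "'n \<Rightarrow> 'n"
  proof (cases "p permutes I")
    case True
    then show ?thesis
      by (auto intro!: prod.neutral simp: permutes_not_in)
  next
    case False
    then obtain i where "i \<notin> I" "p i \<noteq> i"
      using p unfolding permutes_def by blast
    with False show ?thesis
      by (auto intro!: prod_zero bexI[of _ i])
  qed
  then have "(\<Sum>p | p permutes UNIV. of_int (sign p) *
      ((\<Prod>i\<in>I. A i (p i)) * (\<Prod>i\<in>UNIV - I. if i = p i then 1 else 0))) =
    (\<Sum>p | p permutes UNIV. if p permutes I then of_int (sign p) * (\<Prod>i\<in>I. A i (p i)) else 0)"
    by (intro sum.cong) auto
  also have "\<dots> = (\<Sum>p \<in> {p. p permutes UNIV} \<inter> {p. p permutes I}. of_int (sign p) * (\<Prod>i\<in>I. A i (p i)))"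
    by (subst sum.inter_restrict) (auto simp: finite_permutations)
  also have "{p. p permutes UNIV} \<inter> {p. p permutes I} = {p. p permutes I}"
    by (auto intro: permutes_subset)
  finally show ?thesis
    by (simp add: principal_minor_def)
qed

lemma det_mat_1_plus:
  fixes A :: "real^'n^'n"
  shows "det (mat 1 + A) = (\<Sum>I\<in>Pow UNIV. principal_minor I (\<lambda>i j. A $ i $ j))"
proof -
  have "det (mat 1 + A) =
    (\<Sum>p | p permutes UNIV. of_int (sign p) * (\<Prod>i\<in>UNIV. A $ i $ p i + (if i = p i then 1 else 0)))"
    by (simp add: det_def mat_def add.commute)
  also have "\<dots> = (\<Sum>p | p permutes UNIV. \<Sum>I\<in>Pow UNIV. of_int (sign p) *
      ((\<Prod>i\<in>I. A $ i $ p i) * (\<Prod>i\<in>UNIV - I. if i = p i then 1 else 0)))"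
    \<comment> \<open>Multiplying out each product amounts to choosing the set \<open>I\<close> of
      rows whose factor comes from \<open>A\<close>; the other rows contribute their entry of the
      identity.\<close>
    by (subst prod_add) (simp_all add: sum_distrib_left)
  also have "\<dots> = (\<Sum>I\<in>Pow UNIV. principal_minor I (\<lambda>i j. A $ i $ j))"
    by (subst sum.swap) (intro sum.cong refl sum_permutes_identity_rows[of "\<lambda>i j. A $ i $ j"])
  finally show ?thesis .
qed

definition identity_outside :: "'n::finite set \<Rightarrow> ('n \<Rightarrow> 'n \<Rightarrow> real) \<Rightarrow> real^'n^'n" where
  "identity_outside I A = (\<chi> i j. if i \<in> I \<and> j \<in> I then A i j else if i = j then 1 else 0)"

text \<open>This makes a minor a genuine determinant of fixed size, so that facts on invertibility,
  matrix products and linear images apply to minors.\<close>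

lemma det_identity_outside: "det (identity_outside I A) = principal_minor I A"
proof -
  let ?M = "identity_outside I A"
  have "(\<Prod>i\<in>UNIV. ?M $ i $ p i) =
    (\<Prod>i\<in>I. ?M $ i $ p i) * (\<Prod>i\<in>UNIV - I. if i = p i then 1 else 0)" for p
    by (subst prod.subset_diff[of I UNIV])
       (auto intro!: prod.cong simp: identity_outside_def mult.commute)
  then have "det ?M = principal_minor I (\<lambda>i j. ?M $ i $ j)"
    using sum_permutes_identity_rows[where I = I and A = "\<lambda>i j. ?M $ i $ j"] by (simp add: det_def)
  also have "\<dots> = principal_minor I A"
    by (rule principal_minor_cong) (simp add: identity_outside_def)
  finally show ?thesis .
qed

text \<open>Conjugation by \<open>f\<close>, written \<open>map_permutation I f\<close>, is a
  bijection from the permutations of \<open>I\<close> to those of \<open>J\<close> and preserves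
  signs. It allows the index type to be exchanged for another one.\<close>

lemma principal_minor_reindex:
  assumes f: "bij_betw f I J" and "finite I"
  shows "principal_minor J A = principal_minor I (\<lambda>i j. A (f i) (f j))"
proof -
  let ?\<pi> = "map_permutation I f"
  have inj: "inj_on f I"
    using f by (simp add: bij_betw_def)
  have "principal_minor J A = (\<Sum>p | p permutes I. of_int (sign (?\<pi> p)) * (\<Prod>j\<in>J. A j (?\<pi> p j)))"
    unfolding principal_minor_def
    by (rule sum.reindex_bij_betw[symmetric])
       (use bij_betw_permutations[OF f] f in
        \<open>simp add: map_permutation_def restrict_id_def o_def bij_betw_imp_surj_on\<close>)
  also have "\<dots> = principal_minor I (\<lambda>i j. A (f i) (f j))"
    unfolding principal_minor_def
  proof (intro sum.cong refl arg_cong2[where f = "(*)"])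
    fix p assume "p \<in> {p. p permutes I}"
    then have p: "p permutes I" by simp
    show "real_of_int (sign (?\<pi> p)) = real_of_int (sign p)"
      using inj p \<open>finite I\<close> by (simp add: sign_map_permutation)
    show "(\<Prod>j\<in>J. A j (?\<pi> p j)) = (\<Prod>i\<in>I. A (f i) (f (p i)))"
      by (subst prod.reindex_bij_betw[OF f, symmetric])
         (auto intro!: prod.cong simp: map_permutation_apply[OF inj])
  qed
  finally show ?thesis .
qed

section \<open>Vanishing of the minors of dependent families\<close>

lemma principal_minor_eq_0:
  fixes A :: "'n::finite \<Rightarrow> 'n \<Rightarrow> real"
  assumes "\<And>i. i \<in> I \<Longrightarrow> (\<Sum>j\<in>I. A i j * x j) = 0" and "k \<in> I" "x k \<noteq> 0"
  shows "principal_minor I A = 0"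
proof -
  \<comment> \<open>Extending \<open>x\<close> by 0 also annihilates the identity rows outside
    \<open>I\<close>, so \<open>y\<close> is a nonzero kernel vector of the padded matrix.\<close>
  define y where "y = (\<chi> j. if j \<in> I then x j else 0)"
  have *: "(\<Sum>j\<in>UNIV. identity_outside I A $ i $ j * y $ j) = (\<Sum>j\<in>I. identity_outside I A $ i $ j * x j)" for i
    by (rule sum.mono_neutral_cong_right) (auto simp: y_def)
  have "(\<Sum>j\<in>I. identity_outside I A $ i $ j * x j) = 0" for i
  proof (cases "i \<in> I")
    case True
    then show ?thesis by (simp add: identity_outside_def assms(1))
  qed (auto simp: identity_outside_def intro!: sum.neutral)
  then have "identity_outside I A *v y = 0"
    by (simp only: vec_eq_iff matrix_vector_mult_def vec_lambda_beta * zero_index) simp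
  moreover have "y \<noteq> 0"
    using assms(2,3) by (auto simp: vec_eq_iff y_def)
  ultimately have "\<not> invertible (identity_outside I A)"
    by (metis invertible_left_inverse matrix_left_invertible_ker)
  then show ?thesis
    by (simp add: invertible_det_nz det_identity_outside)
qed

lemma sum_delta_scaleR:
  fixes w :: "'i \<Rightarrow> 'a::real_vector"
  assumes "finite I" "k \<in> I"
  shows "(\<Sum>i\<in>I. (if i = k then 1 else 0) *\<^sub>R w i) = w k"
proof -
  have "(\<Sum>i\<in>I. (if i = k then 1 else 0) *\<^sub>R w i) = (\<Sum>i\<in>I. if i = k then w i else 0)"
    by (intro sum.cong) auto
  then show ?thesis
    using assms by simp
qed

text \<open>A linear relation among the indexed vectors, paired with each \<open>w i\<close> by the
  inner product, becomes a kernel vector of the Gram matrix.\<close>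

lemma principal_minor_gram_eq_0:
  fixes w :: "'n::finite \<Rightarrow> 'a::euclidean_space"
  assumes "\<not> (inj_on w I \<and> independent (w ` I))"
  shows "principal_minor I (\<lambda>i j. w i \<bullet> w j) = 0"
proof -
  obtain x k where "(\<Sum>j\<in>I. x j *\<^sub>R w j) = 0" "k \<in> I" "x k \<noteq> 0"
  proof (cases "inj_on w I")
    case True
    with assms obtain u k where "(\<Sum>v\<in>w ` I. u v *\<^sub>R v) = 0" "k \<in> I" "u (w k) \<noteq> 0"
      by (auto simp: dependent_finite)
    with True show ?thesis
      by (intro that[of "u \<circ> w" k]) (simp_all add: sum.reindex)
  next
    case False
    then obtain i k where ik: "i \<in> I" "k \<in> I" "i \<noteq> k" "w i = w k"
      by (auto simp: inj_on_def)
    \<comment> \<open>A repeated vector gives a relation with coefficients 1 and -1 at the two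
      indices.\<close>
    have "(\<Sum>j\<in>I. ((if j = i then 1 else 0) - (if j = k then 1 else 0)) *\<^sub>R w j) = w i - w k"
      using ik by (simp only: scaleR_left_diff_distrib sum_subtractf sum_delta_scaleR finite)
    with ik show ?thesis
      by (intro that[of "\<lambda>j. (if j = i then 1 else 0) - (if j = k then 1 else 0)" k]) auto
  qed
  then show ?thesis
  proof (intro principal_minor_eq_0)
    show "(\<Sum>j\<in>I. w i \<bullet> w j * x j) = 0" if "(\<Sum>j\<in>I. x j *\<^sub>R w j) = 0" for i
      using arg_cong[OF that, of "inner (w i)"] by (simp add: inner_sum_right mult.commute)
  qed
qed

section \<open>Lebesgue measure as a product of basis coordinates and padding coordinates\<close>

text \<open>The first component holds coefficients with respect to an orthonormal set, indexed by
  the vectors themselves and relabelled through \<open>\<sigma>\<close>; the second supplies the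
  padding coordinates outside \<open>J\<close>.\<close>

definition join_coords :: "'m set \<Rightarrow> ('m \<Rightarrow> 'b) \<Rightarrow> ('b \<Rightarrow> real) \<times> ('m \<Rightarrow> real) \<Rightarrow> real^'m" where
  "join_coords J \<sigma> x = (\<chi> i. if i \<in> J then fst x (\<sigma> i) else snd x i)"

lemma join_coords_measurable:
  assumes "bij_betw \<sigma> J B"
  shows "join_coords J \<sigma> \<in> borel_measurable ((\<Pi>\<^sub>M b\<in>B. lborel) \<Otimes>\<^sub>M (\<Pi>\<^sub>M i\<in>- J. lborel))"
    (is "_ \<in> borel_measurable ?M")
proof -
  have comp: "(\<lambda>x. join_coords J \<sigma> x $ i) \<in> borel_measurable ?M" for i
  proof (cases "i \<in> J")
    case True
    then have \<sigma>i: "\<sigma> i \<in> B"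
      using assms by (auto simp: bij_betw_def)
    have "(\<lambda>x. fst x (\<sigma> i)) \<in> ?M \<rightarrow>\<^sub>M lborel"
      by (rule measurable_compose[OF measurable_fst measurable_component_singleton[OF \<sigma>i]])
    then show ?thesis using True by (simp add: join_coords_def)
  next
    case False
    then have i: "i \<in> - J" by simp
    have "(\<lambda>x. snd x i) \<in> ?M \<rightarrow>\<^sub>M lborel"
      by (rule measurable_compose[OF measurable_snd measurable_component_singleton[OF i]])
    then show ?thesis using False by (simp add: join_coords_def)
  qed
  show ?thesis
    by (subst borel_measurable_euclidean_space)
       (auto simp: Basis_vec_def inner_axis comp)
qed

lemma emeasure_PiM_lborel:
  assumes "finite I" "\<And>i. i \<in> I \<Longrightarrow> A i \<in> sets borel"
  shows "emeasure (\<Pi>\<^sub>M i\<in>I. (lborel :: real measure)) (Pi\<^sub>E I A) = (\<Prod>i\<in>I. emeasure lborel (A i))"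
proof -
  interpret product_sigma_finite "\<lambda>_. lborel :: real measure" ..
  show ?thesis
    using assms by (simp add: emeasure_PiM)
qed

text \<open>Lebesgue measure is determined by its values on boxes. The preimage of a box under
  \<open>join_coords\<close> is a product of two boxes, and the product of their measures collects
  exactly the side lengths of the original box.\<close>

lemma lborel_eq_distr_join_coords:
  assumes \<sigma>: "bij_betw \<sigma> J B"
  shows "(lborel :: (real^'m) measure) =
    distr ((\<Pi>\<^sub>M b\<in>B. lborel) \<Otimes>\<^sub>M (\<Pi>\<^sub>M i\<in>- J. lborel)) borel (join_coords J \<sigma>)"
    (is "_ = distr ?M _ ?\<Phi>")
proof (rule lborel_eqI)
  have "finite B"
    using \<sigma> by (metis bij_betw_finite finite)
  interpret JF: finite_product_sigma_finite "\<lambda>_::'m. lborel :: real measure" "- J"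
    by standard simp
  fix l u :: "real^'m" assume le: "\<And>b. b \<in> Basis \<Longrightarrow> l \<bullet> b \<le> u \<bullet> b"
  then have le': "l $ i \<le> u $ i" for i
    using le[of "axis i 1"] by (simp add: inner_axis)
  let ?\<tau> = "inv_into J \<sigma>"
  let ?X = "\<Pi>\<^sub>E b\<in>B. {l $ ?\<tau> b <..< u $ ?\<tau> b}"
  let ?Y = "\<Pi>\<^sub>E i\<in>- J. {l $ i <..< u $ i}"
  have "?\<Phi> -` box l u \<inter> space ?M = ?X \<times> ?Y"
  proof -
    have "?\<Phi> (c, d) \<in> box l u \<longleftrightarrow>
      (\<forall>b\<in>B. c b \<in> {l $ ?\<tau> b <..< u $ ?\<tau> b}) \<and> (\<forall>i\<in>- J. d i \<in> {l $ i <..< u $ i})" for c d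
    proof -
      have "?\<Phi> (c, d) \<in> box l u \<longleftrightarrow>
        (\<forall>i\<in>J. c (\<sigma> i) \<in> {l $ i <..< u $ i}) \<and> (\<forall>i\<in>- J. d i \<in> {l $ i <..< u $ i})"
        by (auto simp: mem_box_cart join_coords_def)
      also have "(\<forall>i\<in>J. c (\<sigma> i) \<in> {l $ i <..< u $ i}) \<longleftrightarrow> (\<forall>i\<in>J. c (\<sigma> i) \<in> {l $ ?\<tau> (\<sigma> i) <..< u $ ?\<tau> (\<sigma> i)})"
        using \<sigma> by (simp add: bij_betw_inv_into_left)
      also have "\<dots> \<longleftrightarrow> (\<forall>b\<in>B. c b \<in> {l $ ?\<tau> b <..< u $ ?\<tau> b})"
        using bij_betw_imp_surj_on[OF \<sigma>] by blast
      finally show ?thesis .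
    qed
    then show ?thesis
      by (auto simp: space_pair_measure space_PiM PiE_iff simp del: greaterThanLessThan_iff)
  qed
  then have "emeasure (distr ?M borel ?\<Phi>) (box l u) = emeasure ?M (?X \<times> ?Y)"
    by (simp add: emeasure_distr join_coords_measurable[OF \<sigma>])
  also have "\<dots> = emeasure (\<Pi>\<^sub>M b\<in>B. lborel) ?X * emeasure (\<Pi>\<^sub>M i\<in>- J. lborel) ?Y"
    using \<open>finite B\<close> by (intro JF.emeasure_pair_measure_Times sets_PiM_I_finite) auto
  also have "\<dots> = (\<Prod>b\<in>B. ennreal (u $ ?\<tau> b - l $ ?\<tau> b)) * (\<Prod>i\<in>-J. ennreal (u $ i - l $ i))"
    using \<open>finite B\<close> le' by (simp add: emeasure_PiM_lborel)
  also have "(\<Prod>b\<in>B. ennreal (u $ ?\<tau> b - l $ ?\<tau> b)) = (\<Prod>i\<in>J. ennreal (u $ i - l $ i))"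
    using \<sigma> by (subst prod.reindex_bij_betw[OF \<sigma>, symmetric]) (auto intro!: prod.cong simp: bij_betw_inv_into_left)
  also have "\<dots> * (\<Prod>i\<in>-J. ennreal (u $ i - l $ i)) = (\<Prod>i\<in>UNIV. ennreal (u $ i - l $ i))"
    by (metis Compl_eq_Diff_UNIV finite mult.commute prod.subset_diff subset_UNIV)
  also have "\<dots> = (\<Prod>b\<in>Basis. (u - l) \<bullet> b)"
  proof -
    have Basis_eq: "(Basis :: (real^'m) set) = range (\<lambda>i. axis i 1)"
      by (auto simp: Basis_vec_def)
    have inj: "inj (\<lambda>i. axis i 1 :: real^'m)"
      by (auto simp: inj_on_def axis_eq_axis)
    have "(\<Prod>b\<in>Basis. (u - l) \<bullet> b) = (\<Prod>i\<in>UNIV. u $ i - l $ i)"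
      unfolding Basis_eq by (simp add: prod.reindex[OF inj] inner_axis)
    then show ?thesis
      using le' by (simp add: prod_ennreal)
  qed
  finally show "emeasure (distr ?M borel ?\<Phi>) (box l u) = (\<Prod>b\<in>Basis. (u - l) \<bullet> b)" .
qed simp

section \<open>The volume of a parallelepiped as a determinant\<close>

text \<open>The set is a continuous image of the compact unit cube. Closedness provides the Borel
  measurability needed to evaluate its measure.\<close>

lemma closed_parallelepiped:
  fixes w :: "'i::finite \<Rightarrow> 'a::euclidean_space"
  shows "closed (parallelepiped I w)"
proof -
  let ?f = "\<lambda>x::real^'i. \<Sum>i\<in>I. x $ i *\<^sub>R w i"
  have "parallelepiped I w = ?f ` cbox 0 1"
  proof safe
    fix v assume "v \<in> parallelepiped I w"
    then obtain c where "v = (\<Sum>i\<in>I. c i *\<^sub>R w i)" "\<forall>i\<in>I. c i \<in> {0..1}"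
      by (auto simp: parallelepiped_def)
    then show "v \<in> ?f ` cbox 0 1"
      by (intro image_eqI[of _ _ "\<chi> i. if i \<in> I then c i else 0"]) (auto simp: mem_box_cart)
  qed (auto simp: parallelepiped_def mem_box_cart)
  moreover have "compact (?f ` cbox 0 1)"
    by (intro compact_continuous_image continuous_intros compact_cbox)
  ultimately show ?thesis
    by (simp add: compact_imp_closed)
qed

text \<open>The product with the unit cube in the coordinates outside \<open>J\<close> has the same
  measure. In joined coordinates this product is the image of the full unit cube under the
  transposed padded matrix, so its measure is the absolute value of the determinant.\<close>

lemma measure_lborel_span_parallelepiped:
  fixes w :: "'m::{finite,wellorder} \<Rightarrow> 'a::euclidean_space"
  assumes B: "orthonormal B" and \<sigma>: "bij_betw \<sigma> J B" and sub: "parallelepiped J w \<subseteq> span B"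
  shows "measure (lborel_span B) (parallelepiped J w) = \<bar>principal_minor J (\<lambda>i j. w i \<bullet> \<sigma> j)\<bar>"
proof -
  have "finite B"
    using \<sigma> by (metis bij_betw_finite finite)
  interpret JF: finite_product_sigma_finite "\<lambda>_. lborel :: real measure" "- J"
    by standard simp
  let ?MB = "\<Pi>\<^sub>M b\<in>B. (lborel :: real measure)" and ?MJ = "\<Pi>\<^sub>M i\<in>- J. (lborel :: real measure)"
  let ?P = "parallelepiped J w" and ?s = "\<lambda>c. \<Sum>b\<in>B. c b *\<^sub>R b"
  let ?A = "identity_outside J (\<lambda>i j. w i \<bullet> \<sigma> j)"
  let ?T = "?s -` ?P \<inter> space ?MB" and ?U = "\<Pi>\<^sub>E i\<in>- J. {0..1::real}"
  let ?Q = "(\<lambda>x. transpose ?A *v x) ` cbox 0 1"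
  have s: "?s \<in> borel_measurable ?MB"
    by measurable
  have P: "?P \<in> sets borel"
    by (simp add: closed_parallelepiped)
  have T: "?T \<in> sets ?MB"
    by (rule measurable_sets[OF s P])
  have Q: "compact ?Q"
    by (intro compact_continuous_image matrix_vector_mult_linear_continuous_on compact_cbox)
  have bb: "b \<bullet> b' = (if b = b' then 1 else 0)" if "b \<in> B" "b' \<in> B" for b b'
    using B that by (auto simp: orthonormal_def pairwise_def orthogonal_def norm_eq_1)
  \<comment> \<open>Coefficients in an orthonormal basis are inner products, so an equation inside
    \<open>span B\<close> can be checked one coordinate at a time.\<close>
  have s_eq: "?s c = v \<longleftrightarrow> (\<forall>i\<in>J. c (\<sigma> i) = v \<bullet> \<sigma> i)" if v: "v \<in> span B" for c v
  proof -
    have s_inner: "?s c \<bullet> b = c b" if "b \<in> B" for c b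
    proof -
      have "?s c \<bullet> b = (\<Sum>b'\<in>B. if b' = b then c b' else 0)"
        using that by (auto simp: inner_sum_left bb intro!: sum.cong)
      then show ?thesis using that \<open>finite B\<close> by simp
    qed
    obtain u where u: "v = ?s u"
      using v \<open>finite B\<close> by (auto simp: span_finite)
    have "?s c = v \<longleftrightarrow> (\<forall>b\<in>B. c b = u b)"
      unfolding u by (metis (no_types, lifting) s_inner sum.cong)
    also have "\<dots> \<longleftrightarrow> (\<forall>b\<in>B. c b = v \<bullet> b)"
      by (auto simp: u s_inner)
    also have "\<dots> \<longleftrightarrow> (\<forall>i\<in>J. c (\<sigma> i) = v \<bullet> \<sigma> i)"
      using bij_betw_imp_surj_on[OF \<sigma>] by blast
    finally show ?thesis .
  qed
  have Av: "(transpose ?A *v x) $ j =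
    (if j \<in> J then (\<Sum>i\<in>J. x $ i *\<^sub>R w i) \<bullet> \<sigma> j else x $ j)" for x j
  proof -
    have "(transpose ?A *v x) $ j = (\<Sum>i\<in>UNIV. ?A $ i $ j * x $ i)"
      by (simp add: matrix_vector_mult_def transpose_def)
    also have "\<dots> = (if j \<in> J then (\<Sum>i\<in>J. x $ i * (w i \<bullet> \<sigma> j)) else x $ j)"
    proof (cases "j \<in> J")
      case True
      then have "(\<Sum>i\<in>UNIV. ?A $ i $ j * x $ i) = (\<Sum>i\<in>J. x $ i * (w i \<bullet> \<sigma> j))"
        by (intro sum.mono_neutral_cong_right) (auto simp: identity_outside_def)
      with True show ?thesis by simp
    next
      case False
      then have "(\<Sum>i\<in>UNIV. ?A $ i $ j * x $ i) = (\<Sum>i\<in>UNIV. if i = j then x $ i else 0)"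
        by (intro sum.cong) (auto simp: identity_outside_def)
      with False show ?thesis by simp
    qed
    finally show ?thesis by (simp add: inner_sum_left)
  qed
  have join_eq: "join_coords J \<sigma> (c, d) = transpose ?A *v x \<longleftrightarrow>
    (\<forall>j\<in>J. c (\<sigma> j) = (\<Sum>i\<in>J. x $ i *\<^sub>R w i) \<bullet> \<sigma> j) \<and> (\<forall>j\<in>- J. d j = x $ j)" for c d x
    unfolding vec_eq_iff Av join_coords_def by auto
  have join_Q: "join_coords J \<sigma> (c, d) \<in> ?Q \<longleftrightarrow> ?s c \<in> ?P \<and> (\<forall>i\<in>- J. d i \<in> {0..1})" for c d
  proof -
    have "join_coords J \<sigma> (c, d) \<in> ?Q \<longleftrightarrow>
      (\<exists>x\<in>cbox 0 1. (\<forall>j\<in>J. c (\<sigma> j) = (\<Sum>i\<in>J. x $ i *\<^sub>R w i) \<bullet> \<sigma> j) \<and> (\<forall>j\<in>- J. d j = x $ j))"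
      unfolding image_iff join_eq ..
    also have "\<dots> \<longleftrightarrow> (\<exists>x\<in>cbox 0 1. ?s c = (\<Sum>i\<in>J. x $ i *\<^sub>R w i) \<and> (\<forall>j\<in>- J. d j = x $ j))"
    proof (intro bex_cong refl conj_cong)
      fix x :: "real^'m::_" assume "x \<in> cbox 0 1"
      then have "(\<Sum>i\<in>J. x $ i *\<^sub>R w i) \<in> ?P"
        by (auto simp: parallelepiped_def mem_box_cart)
      with sub show "(\<forall>j\<in>J. c (\<sigma> j) = (\<Sum>i\<in>J. x $ i *\<^sub>R w i) \<bullet> \<sigma> j) = (?s c = (\<Sum>i\<in>J. x $ i *\<^sub>R w i))"
        by (subst s_eq) auto
    qed
    also have "\<dots> \<longleftrightarrow> ?s c \<in> ?P \<and> (\<forall>i\<in>- J. d i \<in> {0..1})" (is "?L \<longleftrightarrow> ?R")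
    proof
      assume ?R
      then obtain x where x: "?s c = (\<Sum>i\<in>J. x i *\<^sub>R w i)" "\<forall>i\<in>J. x i \<in> {0..1}"
        by (auto simp: parallelepiped_def)
      with \<open>?R\<close> show ?L
        \<comment> \<open>The cube point takes the parallelepiped coefficients on \<open>J\<close>
          and the padding coordinates elsewhere.\<close>
        by (intro bexI[of _ "\<chi> i. if i \<in> J then x i else d i"]) (auto simp: mem_box_cart)
    qed (auto simp: parallelepiped_def mem_box_cart)
    finally show ?thesis .
  qed
  have "emeasure (lborel_span B) ?P = emeasure ?MB ?T"
    by (simp add: lborel_span_def emeasure_distr[OF s P])
  \<comment> \<open>The unit cube \<open>?U\<close> has measure 1, also when \<open>- J\<close> is
    empty.\<close>
  also have "\<dots> = emeasure ?MB ?T * emeasure ?MJ ?U"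
    by (simp add: emeasure_PiM_lborel)
  also have "\<dots> = emeasure (?MB \<Otimes>\<^sub>M ?MJ) (?T \<times> ?U)"
    by (intro JF.emeasure_pair_measure_Times[symmetric] T sets_PiM_I_finite) auto
  also have "?T \<times> ?U = join_coords J \<sigma> -` ?Q \<inter> space (?MB \<Otimes>\<^sub>M ?MJ)"
    using join_Q by (auto simp: space_pair_measure space_PiM PiE_iff simp del: atLeastAtMost_iff)
  also have "emeasure (?MB \<Otimes>\<^sub>M ?MJ) \<dots> = emeasure lborel ?Q"
    by (subst lborel_eq_distr_join_coords[OF \<sigma>], rule emeasure_distr[symmetric])
       (use Q in \<open>simp_all add: join_coords_measurable[OF \<sigma>] compact_imp_closed\<close>)
  \<comment> \<open>\<open>?Q\<close> is compact, hence Borel, so \<open>lborel\<close> and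
    \<open>lebesgue\<close> agree on it.\<close>
  finally have "measure (lborel_span B) ?P = measure lebesgue ?Q"
    using Q by (simp add: measure_def compact_imp_closed)
  also have "\<dots> = \<bar>det (matrix (\<lambda>x. transpose ?A *v x))\<bar> * measure lebesgue (cbox 0 1 :: (real^'m::_) set)"
    by (rule measure_linear_image[OF matrix_vector_mul_linear]) simp
  also have "det (matrix (\<lambda>x. transpose ?A *v x)) = det ?A"
    by (simp only: matrix_of_matrix_vector_mul det_transpose)
  also have "measure lebesgue (cbox 0 1 :: (real^'m::_) set) = 1"
    by (simp add: content_cbox_if_cart interval_eq_empty_cart)
  finally show ?thesis
    by (simp add: det_identity_outside)
qed

section \<open>Gram minors and squared volumes\<close>

text \<open>If \<open>A\<close> is the padded matrix of coordinates of the vectors in the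
  orthonormal basis, then \<open>A ** transpose A\<close> is the padded Gram matrix by Parseval's
  identity, and taking determinants gives the square.\<close>

lemma principal_minor_gram:
  fixes w :: "'n::finite \<Rightarrow> 'a::euclidean_space"
  assumes B: "orthonormal B" and \<sigma>: "bij_betw \<sigma> J B" and sub: "w ` J \<subseteq> span B"
  shows "principal_minor J (\<lambda>i j. w i \<bullet> w j) = (principal_minor J (\<lambda>i j. w i \<bullet> \<sigma> j))\<^sup>2"
proof -
  have "finite B"
    using \<sigma> by (metis bij_betw_finite finite)
  have bb: "b \<bullet> b' = (if b = b' then 1 else 0)" if "b \<in> B" "b' \<in> B" for b b'
    using B that by (auto simp: orthonormal_def pairwise_def orthogonal_def norm_eq_1)
  let ?A = "identity_outside J (\<lambda>i j. w i \<bullet> \<sigma> j)"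
  have parseval: "(\<Sum>k\<in>J. (w i \<bullet> \<sigma> k) * (w j \<bullet> \<sigma> k)) = w i \<bullet> w j" if "i \<in> J" "j \<in> J" for i j
  proof -
    obtain u where u: "w i = (\<Sum>b\<in>B. u b *\<^sub>R b)"
      using sub \<open>i \<in> J\<close> \<open>finite B\<close> by (auto simp: span_finite)
    have "w i \<bullet> b = u b" if "b \<in> B" for b
    proof -
      have "w i \<bullet> b = (\<Sum>b'\<in>B. if b' = b then u b' else 0)"
        using that by (auto simp: u inner_sum_left bb intro!: sum.cong)
      then show ?thesis using that \<open>finite B\<close> by simp
    qed
    then have "(\<Sum>b\<in>B. (w i \<bullet> b) * (b \<bullet> w j)) = (\<Sum>b\<in>B. u b *\<^sub>R b) \<bullet> w j"
      by (simp add: inner_sum_left)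
    also have "\<dots> = w i \<bullet> w j"
      by (simp only: u)
    also have "(\<Sum>b\<in>B. (w i \<bullet> b) * (b \<bullet> w j)) = (\<Sum>k\<in>J. (w i \<bullet> \<sigma> k) * (\<sigma> k \<bullet> w j))"
      by (rule sum.reindex_bij_betw[OF \<sigma>, symmetric])
    finally show ?thesis by (simp add: inner_commute)
  qed
  have "?A ** transpose ?A = identity_outside J (\<lambda>i j. w i \<bullet> w j)"
  proof (simp add: vec_eq_iff matrix_matrix_mult_def transpose_def, intro allI)
    fix i j
    show "(\<Sum>k\<in>UNIV. ?A $ i $ k * ?A $ j $ k) = identity_outside J (\<lambda>i j. w i \<bullet> w j) $ i $ j"
    proof (cases "i \<in> J \<and> j \<in> J")
      case True
      then have "(\<Sum>k\<in>UNIV. ?A $ i $ k * ?A $ j $ k) = (\<Sum>k\<in>J. (w i \<bullet> \<sigma> k) * (w j \<bullet> \<sigma> k))"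
        by (intro sum.mono_neutral_cong_right) (auto simp: identity_outside_def)
      with True show ?thesis by (simp add: parseval identity_outside_def)
    next
      case False
      then have "(\<Sum>k\<in>UNIV. ?A $ i $ k * ?A $ j $ k) = (\<Sum>k\<in>UNIV. if k = i then if i = j then 1 else 0 else 0)"
        by (intro sum.cong) (auto simp: identity_outside_def)
      with False show ?thesis by (auto simp: identity_outside_def)
    qed
  qed
  from arg_cong[OF this, of det] show ?thesis
    by (simp add: det_mul det_identity_outside power2_eq_square)
qed

lemma parallelepiped_image:
  assumes "inj_on f I"
  shows "parallelepiped (f ` I) w = parallelepiped I (w \<circ> f)"
proof (intro subset_antisym subsetI)
  fix v assume "v \<in> parallelepiped (f ` I) w"
  then obtain c where "v = (\<Sum>i\<in>f ` I. c i *\<^sub>R w i)" "\<forall>i\<in>f ` I. c i \<in> {0..1}"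
    by (auto simp: parallelepiped_def)
  with assms show "v \<in> parallelepiped I (w \<circ> f)"
    by (auto simp: parallelepiped_def sum.reindex intro!: exI[of _ "c \<circ> f"])
next
  fix v assume "v \<in> parallelepiped I (w \<circ> f)"
  then obtain c where "v = (\<Sum>i\<in>I. c i *\<^sub>R w (f i))" "\<forall>i\<in>I. c i \<in> {0..1}"
    by (auto simp: parallelepiped_def)
  with assms show "v \<in> parallelepiped (f ` I) w"
    by (auto simp: parallelepiped_def sum.reindex intro!: exI[of _ "c \<circ> inv_into I f"])
qed

text \<open>Through this, a subspace containing the parallelepiped is seen to contain its spanning
  vectors, as \<open>principal_minor_gram\<close> requires.\<close>

lemma generators_subset_parallelepiped:
  assumes "finite I"
  shows "w ` I \<subseteq> parallelepiped I w"
proof (rule image_subsetI)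
  fix k assume "k \<in> I"
  then have "w k = (\<Sum>i\<in>I. (if i = k then 1 else 0) *\<^sub>R w i)"
    using assms by (simp only: sum_delta_scaleR)
  then show "w k \<in> parallelepiped I w"
    unfolding parallelepiped_def by (intro CollectI exI[of _ "\<lambda>i. if i = k then 1 else 0"]) auto
qed

lemma parallelepiped_subset_span: "parallelepiped I w \<subseteq> span (w ` I)"
  by (auto simp: parallelepiped_def intro: span_sum span_scale span_base)

lemma volume_parallelepiped_square:
  fixes w :: "'n::finite \<Rightarrow> 'a::euclidean_space"
  shows "(volume (card I) (parallelepiped I w))\<^sup>2 = principal_minor I (\<lambda>i j. w i \<bullet> w j)"
proof -
  let ?P = "parallelepiped I w"
  let ?Q = "\<lambda>B. orthonormal B \<and> finite B \<and> card B = card I \<and> ?P \<subseteq> span B"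
  show ?thesis
  proof (cases "Ex ?Q")
    case True
    \<comment> \<open>This is the very basis chosen in \<open>volume\<close>; only its defining
      properties enter the computation.\<close>
    define B where "B = Eps ?Q"
    have "?Q B"
      unfolding B_def by (rule someI_ex[OF True])
    then have B: "orthonormal B" "finite B" "card B = card I" "?P \<subseteq> span B"
      by blast+
    have vol: "volume (card I) ?P = measure (lborel_span B) ?P"
      using True by (simp add: volume_def B_def)
    \<comment> \<open>\<open>'n bit0\<close> serves only as a well-ordered index type that is large enough:
      \<open>measure_linear_image\<close> requires a well-order.\<close>
    obtain f :: "'n \<Rightarrow> 'n bit0" where f: "inj f"
      using card_le_inj[of "UNIV :: 'n set" "UNIV :: 'n bit0 set"] by auto
    define J w' where "J = f ` I" and "w' = w \<circ> inv f"
    have bij: "bij_betw f I J"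
      using f by (auto simp: J_def bij_betw_def intro: inj_on_subset)
    have w': "w' (f i) = w i" for i
      using f by (simp add: w'_def)
    have P: "parallelepiped J w' = ?P"
      using bij by (simp add: J_def bij_betw_def parallelepiped_image o_def w')
    obtain \<sigma> where \<sigma>: "bij_betw \<sigma> J B"
      using B bij finite_same_card_bij[of J B] by (auto simp: bij_betw_same_card)
    have sub: "w' ` J \<subseteq> span B"
      using generators_subset_parallelepiped[of J w'] B P by auto
    have "(volume (card I) ?P)\<^sup>2 = (principal_minor J (\<lambda>i j. w' i \<bullet> \<sigma> j))\<^sup>2"
      using measure_lborel_span_parallelepiped[OF B(1) \<sigma>, of w'] B(4) by (simp add: vol P)
    also have "\<dots> = principal_minor J (\<lambda>i j. w' i \<bullet> w' j)"
      by (rule principal_minor_gram[OF B(1) \<sigma> sub, symmetric])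
    also have "\<dots> = principal_minor I (\<lambda>i j. w i \<bullet> w j)"
      by (simp add: principal_minor_reindex[OF bij] w')
    finally show ?thesis .
  next
    case False
    \<comment> \<open>For an independent family, an orthonormal basis of its span would have
      \<open>card I\<close> elements and satisfy \<open>?Q\<close>. So the family is dependent, and
      the Gram minor vanishes just like the default value of \<open>volume\<close>.\<close>
    have "\<not> (inj_on w I \<and> independent (w ` I))"
    proof
      assume *: "inj_on w I \<and> independent (w ` I)"
      obtain B where "pairwise orthogonal B" "\<And>x. x \<in> B \<Longrightarrow> norm x = 1" "independent B"
        "card B = dim (span (w ` I))" "span B = span (w ` I)"
        using orthonormal_basis_subspace[OF subspace_span[of "w ` I"]] by metis
      with * have "?Q B"
        using parallelepiped_subset_span[of I w]
        by (auto simp: orthonormal_def independent_imp_finite dim_eq_card_independent card_image)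
      with False show False by blast
    qed
    moreover have "volume (card I) ?P = 0"
      unfolding volume_def by (rule if_not_P[OF False])
    ultimately show ?thesis
      by (simp add: principal_minor_gram_eq_0)
  qed
qed

section \<open>Equivalence of the two optimization problems\<close>

lemma volume_objective_eq_det:
  fixes H V :: "real^'n^'p"
  shows "volume_objective H V = det (mat 1 + transpose (H + V) ** (H + V))"
proof -
  have "(transpose (H + V) ** (H + V)) $ i $ j =
      (column i H + column i V) \<bullet> (column j H + column j V)" for i j
    by (simp add: matrix_matrix_mult_def transpose_def column_def inner_vec_def)
  then show ?thesis
    by (simp add: volume_objective_def volume_parallelepiped_square det_mat_1_plus)
qed

text \<open>All summands are squares, and the empty index set contributes 1. The resulting
  positivity puts the objective in the range where \<open>ln\<close> is strictly increasing.\<close>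

lemma volume_objective_ge_1:
  fixes H V :: "real^'n^'p"
  shows "volume_objective H V \<ge> 1"
proof -
  let ?vol2 = "\<lambda>I. (volume (card I) (parallelepiped I (\<lambda>i. column i H + column i V)))\<^sup>2"
  have "principal_minor ({} :: 'n set) A = 1" for A
    by (simp add: principal_minor_def)
  then have "1 = ?vol2 {}"
    by (simp only: volume_parallelepiped_square)
  also have "\<dots> \<le> (\<Sum>I\<in>Pow UNIV. ?vol2 I)"
    by (rule member_le_sum) auto
  finally show ?thesis
    by (simp add: volume_objective_def)
qed

theorem proposition2:
  fixes H V :: "real^'n^'p" and \<alpha> :: "'n \<Rightarrow> real"
  assumes "\<And>i. \<alpha> i > 0"
    and "feasible \<alpha> V"
  shows "is_arg_max (volume_objective H) (feasible \<alpha>) V \<longleftrightarrow>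
         is_arg_min (logdet_loss H) (feasible \<alpha>) V"
proof -
  have loss: "logdet_loss H W = - ln (volume_objective H W)" for W
    by (simp add: logdet_loss_def volume_objective_eq_det)
  have "volume_objective H W > 0" for W
    using volume_objective_ge_1[of H W] by simp
  \<comment> \<open>On positive values, \<open>- ln\<close> reverses strict inequalities, so a
    feasible point beats \<open>V\<close> in one problem exactly when it does in the other.\<close>
  then show ?thesis
    by (simp add: is_arg_max_def is_arg_min_def loss)
qed

end
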